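(* Let $K$ be a field and let $A=\{\mathbf a_1,\dots,\mathbf a_n\}\subset\mathbb Z_{\ge 0}^d$ be a configuration with toric ideal $I_A\subset K[x_1,\dots,x_n]$. If $I_A$ possesses a fundamental binomial $g=u-v$ ($u,v$ monomials) such that neither $u$ nor $v$ is squarefree, then $K[A]$ is not very ample.
   Context: A configuration in $\mathbb R^d$ is a finite set $A=\{\mathbf a_1,\dots,\mathbf a_n\}\subset\mathbb Z_{\ge 0}^d$ (with $\mathbf a_1,\dots,\mathbf a_n$ distinct) such that there exists $\mathbf w\in\mathbb R^d$ with $\mathbf w\cdot\mathbf a_i=1$ for all $i$. For a field $K$, write $\mathbf t^{\mathbf a}=t_1^{a_1}\cdots t_d^{a_d}$ for $\mathbf a=(a_1,\dots,a_d)$. The semigroup ring of $A$ is $K[A]=K[\mathbf t^{\mathbf a_1},\dots,\mathbf t^{\mathbf a_n}]\subset K[t_1,\dots,t_d]$. The toric ideal $I_A$ is the kernel of the surjective $K$-algebra homomorphism $\pi:K[x_1,\dots,x_n]\to K[A]$, $\pi(x_i)=\mathbf t^{\mathbf a_i}$. $\mathbb Z_{\ge 0}A$, $\mathbb ZA$, $\mathbb Q_{\ge 0}A$ denote the sets of linear combinations of elements of $A$ with coefficients in $\mathbb Z_{\ge 0}$, $\mathbb Z$, $\mathbb Q_{\ge 0}$ respectively. $K[A]$ is very ample if $(\mathbb ZA\cap\mathbb Q_{\ge 0}A)\setminus\mathbb Z_{\ge 0}A$ is a finite (or empty) set. Let $P_A$ be the convex hull of $A$. For a subset $B\subset A$,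 $K[B]$ is a combinatorial pure subring of $K[A]$ if there exists a face $F$ of $P_A$ such that $B=A\cap F$ (a face is the intersection of $P_A$ with a set $\{\mathbf b\in\mathbb R^d:\mathbf v\cdot\mathbf b=c\}$, where $\mathbf v\in\mathbb R^d$, $c\in\mathbb R$ and $\mathbf v\cdot\mathbf b\le c$ for all $\mathbf b\in P_A$; $P_A$ itself is a face). For such $B$, the toric ideal $I_B$ is an ideal of the polynomial ring $K[x_i:\mathbf a_i\in B]\subset K[x_1,\dots,x_n]$. A binomial is a difference of two monomials. A binomial $f\in I_A$ is fundamental if there exists a combinatorial pure subring $K[B]$ of $K[A]$ such that $I_B$ is generated by $f$. A monomial is squarefree if it is not divisible by the square of any variable. *)

theory Defs
  imports "HOL-Analysis.Analysis" "HOL-Library.Poly_Mapping"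
begin

text \<open>
  The polynomial ring over \<open>'k\<close> with variables indexed by a finite type \<open>'n\<close> is the monoid
  algebra of exponent vectors, with the convolution product of \<^theory>\<open>HOL-Library.Poly_Mapping\<close>.
\<close>

type_synonym ('n, 'k) mpoly = "(nat ^ 'n) \<Rightarrow>\<^sub>0 'k"

definition mpoly_monom :: "nat ^ 'n \<Rightarrow> ('n::finite, 'k::field) mpoly"
  where "mpoly_monom m = Poly_Mapping.single m 1"

definition mpoly_var :: "'n \<Rightarrow> ('n::finite, 'k::field) mpoly"
  where "mpoly_var i = mpoly_monom (axis i 1)"

definition mpoly_const :: "'k \<Rightarrow> ('n::finite, 'k::field) mpoly"
  where "mpoly_const c = Poly_Mapping.single 0 c"

definition is_monomial :: "('n::finite, 'k::field) mpoly \<Rightarrow> bool"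
  where "is_monomial p \<longleftrightarrow> p \<in> range mpoly_monom"

definition squarefree_monomial :: "('n::finite, 'k::field) mpoly \<Rightarrow> bool"
  where "squarefree_monomial p \<longleftrightarrow> is_monomial p \<and> (\<forall>i. \<not> mpoly_var i ^ 2 dvd p)"

text \<open>The two monomials of a binomial are distinct, so the zero polynomial is not a binomial.\<close>

definition is_binomial :: "('n::finite, 'k::field) mpoly \<Rightarrow> bool"
  where "is_binomial f \<longleftrightarrow> (\<exists>u v. is_monomial u \<and> is_monomial v \<and> u \<noteq> v \<and> f = u - v)"

definition polys_in :: "'n set \<Rightarrow> ('n::finite, 'k::field) mpoly set"
  where "polys_in I = {p. \<forall>m \<in> Poly_Mapping.keys p. \<forall>i. m $ i \<noteq> 0 \<longrightarrow> i \<in> I}"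

text \<open>
  A configuration is given by the family \<open>a\<close> of its points, so that the variable \<open>mpoly_var i\<close>
  corresponds to the point \<open>a i\<close>; \<open>points a\<close> is the underlying subset of Euclidean space.
\<close>

definition real_vec :: "nat ^ 'd \<Rightarrow> real ^ 'd::finite"
  where "real_vec b = (\<chi> j. real (b $ j))"

definition points :: "('n::finite \<Rightarrow> nat ^ 'd::finite) \<Rightarrow> (real ^ 'd) set"
  where "points a = range (\<lambda>i. real_vec (a i))"

definition configuration :: "('n::finite \<Rightarrow> nat ^ 'd::finite) \<Rightarrow> bool"
  where "configuration a \<longleftrightarrow> inj a \<and> (\<exists>w::real ^ 'd. \<forall>i. w \<bullet> real_vec (a i) = 1)"

definition toric_map ::
    "('n::finite \<Rightarrow> nat ^ 'd::finite) \<Rightarrow> ('n, 'k::field) mpoly \<Rightarrow> ('d, 'k) mpoly"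
  where "toric_map a p =
    (\<Sum>m \<in> Poly_Mapping.keys p. mpoly_const (Poly_Mapping.lookup p m) * (\<Prod>i\<in>UNIV. mpoly_monom (a i) ^ (m $ i)))"

text \<open>
  For a subset \<open>B\<close> of the points, the toric ideal lives in the polynomial ring in the variables
  belonging to \<open>B\<close>; the case \<open>B = points a\<close> is the toric ideal of the whole configuration.
\<close>

definition vars_of :: "('n::finite \<Rightarrow> nat ^ 'd::finite) \<Rightarrow> (real ^ 'd) set \<Rightarrow> 'n set"
  where "vars_of a B = {i. real_vec (a i) \<in> B}"

definition toric_ideal ::
    "('n::finite \<Rightarrow> nat ^ 'd::finite) \<Rightarrow> (real ^ 'd) set \<Rightarrow> ('n, 'k::field) mpoly set"
  where "toric_ideal a B = {p \<in> polys_in (vars_of a B). toric_map a p = 0}"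

definition principal_ideal_in :: "'n set \<Rightarrow> ('n::finite, 'k::field) mpoly \<Rightarrow> ('n, 'k) mpoly set"
  where "principal_ideal_in I f = {h * f | h. h \<in> polys_in I}"

text \<open>
  The polytope itself is an exposed face, and so is the empty set. The conjunct \<open>F face_of P\<close> in
  the library's definition of \<open>F exposed_face_of P\<close> follows from the supporting hyperplane.
\<close>

definition combinatorial_pure :: "(real ^ 'd::finite) set \<Rightarrow> (real ^ 'd) set \<Rightarrow> bool"
  where "combinatorial_pure A B \<longleftrightarrow> (\<exists>F. F exposed_face_of (convex hull A) \<and> B = A \<inter> F)"

definition fundamental_binomial ::
    "('n::finite \<Rightarrow> nat ^ 'd::finite) \<Rightarrow> ('n, 'k::field) mpoly \<Rightarrow> bool"
  where "fundamental_binomial a f \<longleftrightarrow>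
    is_binomial f \<and> f \<in> toric_ideal a (points a) \<and>
    (\<exists>B. combinatorial_pure (points a) B \<and> toric_ideal a B = principal_ideal_in (vars_of a B) f)"

definition combinations :: "real set \<Rightarrow> (real ^ 'd::finite) set \<Rightarrow> (real ^ 'd) set"
  where "combinations S A = {\<Sum>b\<in>A. c b *\<^sub>R b | c. \<forall>b\<in>A. c b \<in> S}"

definition very_ample :: "(real ^ 'd::finite) set \<Rightarrow> bool"
  where "very_ample A \<longleftrightarrow>
    finite ((combinations \<int> A \<inter> combinations {q \<in> \<rat>. 0 \<le> q} A) - combinations \<nat> A)"

end

theory Submission
  imports Defs
begin

text \<open>
  Write \<open>g = x\<^sup>p - x\<^sup>q\<close> and let \<open>J\<close> be the index set of the face \<open>B\<close> on which \<open>g\<close> generates the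
  toric ideal. Every non-trivial relation \<open>\<Sum> r\<^sub>i a\<^sub>i = \<Sum> s\<^sub>i a\<^sub>i\<close> supported on \<open>J\<close> gives a multiple
  \<open>x\<^sup>r - x\<^sup>s\<close> of \<open>g\<close>, and every exponent in a multiple of \<open>g\<close> dominates \<open>p\<close> or \<open>q\<close>. So an exponent
  \<open>r\<close> which dominates neither \<open>p\<close> nor \<open>q\<close> is the only one that represents the point
  \<open>\<Sum> r\<^sub>i a\<^sub>i\<close> (lemma \<open>principal_relation_dominates\<close>). Minimality also forces \<open>p\<close> and \<open>q\<close> to have
  disjoint supports.

  Put \<open>\<beta> = \<Sum> \<lceil>p\<^sub>i/2\<rceil> a\<^sub>i - \<Sum> \<lfloor>q\<^sub>i/2\<rfloor> a\<^sub>i\<close>. Since \<open>\<Sum> p\<^sub>i a\<^sub>i = \<Sum> q\<^sub>i a\<^sub>i\<close>, the double \<open>2 \<beta>\<close> is the sum of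
  the \<open>a\<^sub>i\<close> for which \<open>p\<^sub>i\<close> or \<open>q\<^sub>i\<close> is odd, so \<open>\<beta>\<close> lies in the lattice and in the cone. As
  \<open>p\<close> has an entry at least 2, which halving makes smaller, \<open>\<lceil>p/2\<rceil>\<close> does not dominate \<open>p\<close>; as \<open>q\<close>
  is non-zero and supported elsewhere, \<open>\<lceil>p/2\<rceil>\<close> does not dominate \<open>q\<close> either. Hence
  \<open>\<beta> = \<Sum> s\<^sub>i a\<^sub>i\<close> with integers \<open>s\<^sub>i \<ge> 0\<close> would force \<open>s + \<lfloor>q/2\<rfloor> = \<lceil>p/2\<rceil>\<close>. This is impossible,
  because \<open>q\<close> also has an entry at least 2 and the supports are disjoint.

  To obtain infinitely many holes, add multiples of a point \<open>a\<^sub>k\<close> with \<open>p\<^sub>k > 0\<close>, where \<open>k\<close> differs from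
  a chosen index at which \<open>p\<close> is at least 2: the argument above is unaffected
  (lemma \<open>half_relation_gives_infinitely_many_holes\<close>). Such a \<open>k\<close> is missing only if \<open>p\<close> has
  a single non-zero entry; then the roles of \<open>p\<close> and \<open>q\<close> are exchanged. If both exponents had
  a single non-zero entry, the relation would identify two distinct points of the configuration.
  Finally, a point in the span of a face has only representations inside the face, so holes of
  \<open>B\<close> are holes of the whole configuration.
\<close>

section \<open>Exponent vectors and the points they represent\<close>

definition represented_point :: "('n::finite \<Rightarrow> nat ^ 'd::finite) \<Rightarrow> nat ^ 'n \<Rightarrow> nat ^ 'd"
  where "represented_point a m = (\<Sum>i\<in>UNIV. m $ i *s a i)"

lemma real_vec_add: "real_vec (x + y) = real_vec x + real_vec y"
  by (simp add: real_vec_def vec_eq_iff)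

lemma real_vec_inject: "real_vec x = real_vec y \<longleftrightarrow> x = y"
  by (simp add: real_vec_def vec_eq_iff)

lemma real_vec_represented_point:
  "real_vec (represented_point a m) = (\<Sum>i\<in>UNIV. real (m $ i) *\<^sub>R real_vec (a i))"
  by (simp add: represented_point_def real_vec_def vec_eq_iff)

lemma represented_point_add:
  "represented_point a (m + m') = represented_point a m + represented_point a m'"
  by (simp add: represented_point_def vec_eq_iff sum.distrib algebra_simps)

lemma combinations_points:
  assumes "configuration a"
  shows "combinations S (points a) = {\<Sum>i\<in>UNIV. c i *\<^sub>R real_vec (a i) | c. \<forall>i. c i \<in> S}"
proof -
  have inj: "inj (\<lambda>i. real_vec (a i))"
    using assms by (auto simp: configuration_def inj_def real_vec_inject)
  have *: "(\<Sum>b\<in>points a. c b *\<^sub>R b) = (\<Sum>i\<in>UNIV. c (real_vec (a i)) *\<^sub>R real_vec (a i))" for c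
    unfolding points_def using inj by (subst sum.reindex) auto
  show ?thesis
  proof (intro equalityI subsetI)
    fix x assume "x \<in> combinations S (points a)"
    then obtain c where "x = (\<Sum>b\<in>points a. c b *\<^sub>R b)" "\<forall>b\<in>points a. c b \<in> S"
      by (auto simp: combinations_def)
    then show "x \<in> {\<Sum>i\<in>UNIV. c i *\<^sub>R real_vec (a i) | c. \<forall>i. c i \<in> S}"
      unfolding * by (auto simp: points_def intro!: exI[of _ "\<lambda>i. c (real_vec (a i))"])
  next
    fix x assume "x \<in> {\<Sum>i\<in>UNIV. c i *\<^sub>R real_vec (a i) | c. \<forall>i. c i \<in> S}"
    then obtain c where c: "x = (\<Sum>i\<in>UNIV. c i *\<^sub>R real_vec (a i))" "\<forall>i. c i \<in> S"
      by auto
    define c' where "c' = c \<circ> the_inv (\<lambda>i. real_vec (a i))"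
    have c'_eq: "c' (real_vec (a i)) = c i" for i
      using the_inv_f_f[OF inj, of i] by (simp add: c'_def)
    have "x = (\<Sum>b\<in>points a. c' b *\<^sub>R b)" "\<forall>b\<in>points a. c' b \<in> S"
      unfolding * using c c'_eq by (auto simp: points_def)
    then show "x \<in> combinations S (points a)"
      by (auto simp: combinations_def)
  qed
qed

section \<open>Monomials and the toric map\<close>

lemma mpoly_monom_mult: "mpoly_monom x * mpoly_monom y = mpoly_monom (x + y)"
  by (simp add: mpoly_monom_def Poly_Mapping.mult_single)

lemma mpoly_monom_zero: "mpoly_monom 0 = 1"
  by (simp add: mpoly_monom_def)

lemma mpoly_monom_power: "mpoly_monom x ^ k = mpoly_monom (k *s x)"
proof (induction k)
  case 0
  have "0 *s x = 0"
    by (simp add: vec_eq_iff)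
  then show ?case
    by (simp add: mpoly_monom_zero)
next
  case (Suc k)
  have "Suc k *s x = x + k *s x"
    by (simp add: vec_eq_iff)
  then show ?case
    by (simp add: Suc mpoly_monom_mult)
qed

lemma mpoly_monom_prod: "finite I \<Longrightarrow> (\<Prod>i\<in>I. mpoly_monom (f i)) = mpoly_monom (sum f I)"
  by (induction I rule: finite_induct) (simp_all add: mpoly_monom_zero mpoly_monom_mult)

lemma mpoly_monom_inject:
  "(mpoly_monom x :: ('n::finite, 'k::field) mpoly) = mpoly_monom y \<longleftrightarrow> x = y"
  by (auto simp: mpoly_monom_def dest: arg_cong[of _ _ Poly_Mapping.keys])

lemma lookup_mpoly_monom: "Poly_Mapping.lookup (mpoly_monom x) y = (if x = y then 1 else 0)"
  by (simp add: mpoly_monom_def lookup_single when_def)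

lemma keys_mult_mpoly_monom_ge:
  assumes "m \<in> Poly_Mapping.keys (h * mpoly_monom x)"
  shows "x \<le> m"
proof -
  have "\<exists>k. m = k + x"
    using assms keys_mult[of h "mpoly_monom x"] by (auto simp: mpoly_monom_def split: if_splits)
  then show ?thesis
    by (auto simp: less_eq_vec_def)
qed

lemma keys_mpoly_monom_diff:
  assumes "x \<noteq> y"
  shows "Poly_Mapping.keys (mpoly_monom x - mpoly_monom y :: ('n::finite, 'k::field) mpoly) = {x, y}"
  using assms by (auto simp: in_keys_iff lookup_minus lookup_mpoly_monom split: if_splits)

lemma toric_map_mpoly_monom_diff:
  fixes a :: "'n::finite \<Rightarrow> nat ^ 'd::finite"
  assumes "r \<noteq> s"
  shows "toric_map a (mpoly_monom r - mpoly_monom s :: ('n, 'k::field) mpoly)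
    = mpoly_monom (represented_point a r) - mpoly_monom (represented_point a s)"
proof -
  have image: "(\<Prod>i\<in>UNIV. mpoly_monom (a i) ^ (m $ i)) = (mpoly_monom (represented_point a m) :: ('d, 'k) mpoly)" for m
    by (simp add: mpoly_monom_power mpoly_monom_prod represented_point_def)
  have const: "mpoly_const 1 = (1 :: ('d, 'k) mpoly)" "mpoly_const (- 1) = (- 1 :: ('d, 'k) mpoly)"
    by (simp_all add: mpoly_const_def single_uminus)
  show ?thesis
    using assms
    by (simp add: toric_map_def keys_mpoly_monom_diff image lookup_minus lookup_mpoly_monom const)
qed

lemma mpoly_monom_diff_in_toric_ideal_iff:
  fixes a :: "'n::finite \<Rightarrow> nat ^ 'd::finite"
  assumes "r \<noteq> s"
  shows "(mpoly_monom r - mpoly_monom s :: ('n, 'k::field) mpoly) \<in> toric_ideal a B \<longleftrightarrow>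
    (\<forall>i. r $ i \<noteq> 0 \<or> s $ i \<noteq> 0 \<longrightarrow> i \<in> vars_of a B) \<and> represented_point a r = represented_point a s"
  using assms
  by (auto simp: toric_ideal_def polys_in_def toric_map_mpoly_monom_diff keys_mpoly_monom_diff
      mpoly_monom_inject)

lemma not_squarefree_mpoly_monom:
  assumes "\<not> squarefree_monomial (mpoly_monom p :: ('n::finite, 'k::field) mpoly)"
  obtains i where "p $ i \<ge> 2"
proof -
  obtain i where "mpoly_var i ^ 2 dvd (mpoly_monom p :: ('n, 'k) mpoly)"
    using assms by (auto simp: squarefree_monomial_def is_monomial_def)
  then obtain h :: "('n, 'k) mpoly" where h: "mpoly_monom p = h * mpoly_monom (2 *s axis i 1)"
    by (auto simp: mpoly_var_def mpoly_monom_power elim!: dvdE) (metis mult.commute)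
  have "p \<in> Poly_Mapping.keys (mpoly_monom p :: ('n, 'k) mpoly)"
    by (simp add: mpoly_monom_def)
  then have "2 *s axis i 1 \<le> p"
    unfolding h by (rule keys_mult_mpoly_monom_ge)
  then have "(2 *s axis i 1) $ i \<le> p $ i"
    unfolding less_eq_vec_def by blast
  then have "p $ i \<ge> 2"
    by (simp add: axis_def)
  then show ?thesis
    by (rule that)
qed

section \<open>Toric ideals generated by one binomial\<close>

text \<open>
  The exponent \<open>r\<close> occurs in \<open>x\<^sup>r - x\<^sup>s = h (x\<^sup>p - x\<^sup>q)\<close>, so it must occur in \<open>h x\<^sup>p\<close> or in \<open>h x\<^sup>q\<close>.
\<close>

lemma principal_relation_dominates:
  fixes a :: "'n::finite \<Rightarrow> nat ^ 'd::finite"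
  assumes principal: "toric_ideal a B =
      principal_ideal_in (vars_of a B) (mpoly_monom p - mpoly_monom q :: ('n, 'k::field) mpoly)"
    and supp: "\<And>i. r $ i \<noteq> 0 \<Longrightarrow> i \<in> vars_of a B" "\<And>i. s $ i \<noteq> 0 \<Longrightarrow> i \<in> vars_of a B"
    and rel: "represented_point a r = represented_point a s" and "r \<noteq> s"
  shows "p \<le> r \<or> q \<le> r"
proof -
  have "(mpoly_monom r - mpoly_monom s :: ('n, 'k) mpoly) \<in> toric_ideal a B"
    using assms by (subst mpoly_monom_diff_in_toric_ideal_iff) auto
  then obtain h :: "('n, 'k) mpoly"
    where h: "mpoly_monom r - mpoly_monom s = h * (mpoly_monom p - mpoly_monom q)"
    by (auto simp: principal principal_ideal_in_def)
  have "r \<in> Poly_Mapping.keys (mpoly_monom r - mpoly_monom s :: ('n, 'k) mpoly)"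
    using \<open>r \<noteq> s\<close> by (simp add: keys_mpoly_monom_diff)
  then have "r \<in> Poly_Mapping.keys (h * mpoly_monom p - h * mpoly_monom q)"
    by (simp add: h right_diff_distrib)
  then have "r \<in> Poly_Mapping.keys (h * mpoly_monom p) \<or> r \<in> Poly_Mapping.keys (h * mpoly_monom q)"
    by (auto simp: in_keys_iff lookup_minus)
  then show ?thesis
    using keys_mult_mpoly_monom_ge by blast
qed

text \<open>
  Cancelling a common variable from both monomials would give a relation whose exponents
  are too small to dominate those of the generator.
\<close>

lemma minimal_relation_disjoint_support:
  fixes a :: "'n::finite \<Rightarrow> nat ^ 'd::finite"
  assumes dominates: "\<And>r s. (\<And>i. r $ i \<noteq> 0 \<Longrightarrow> i \<in> J) \<Longrightarrow> (\<And>i. s $ i \<noteq> 0 \<Longrightarrow> i \<in> J) \<Longrightarrow>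
      represented_point a r = represented_point a s \<Longrightarrow> r \<noteq> s \<Longrightarrow> p \<le> r \<or> q \<le> r"
    and supp: "\<And>i. p $ i \<noteq> 0 \<Longrightarrow> i \<in> J" "\<And>i. q $ i \<noteq> 0 \<Longrightarrow> i \<in> J"
    and rel: "represented_point a p = represented_point a q" and "p \<noteq> q"
  shows "p $ i = 0 \<or> q $ i = 0"
proof (rule ccontr)
  assume "\<not> ?thesis"
  then have pos: "p $ i > 0" "q $ i > 0"
    by auto
  define p' q' where "p' = p - axis i 1" and "q' = q - axis i 1"
  have p: "p = p' + axis i 1" and q: "q = q' + axis i 1"
    using pos by (auto simp: p'_def q'_def vec_eq_iff axis_def)
  have rel': "represented_point a p' = represented_point a q'"
    using rel unfolding p q represented_point_add by simp
  have "p' \<noteq> q'"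
    using \<open>p \<noteq> q\<close> p q by auto
  have supp': "\<And>j. p' $ j \<noteq> 0 \<Longrightarrow> j \<in> J" "\<And>j. q' $ j \<noteq> 0 \<Longrightarrow> j \<in> J"
    using supp unfolding p q by auto
  have smaller: "\<not> p \<le> p'" "\<not> q \<le> q'"
    using p q unfolding less_eq_vec_def by (auto simp: axis_def intro!: exI[of _ i])
  have "q \<le> p'"
    using dominates[of p' q'] supp' rel' \<open>p' \<noteq> q'\<close> smaller by blast
  moreover have "p \<le> q'"
    using dominates[of q' p'] supp' rel' \<open>p' \<noteq> q'\<close> smaller by metis
  ultimately have "q $ i \<le> p' $ i" "p $ i \<le> q' $ i"
    unfolding less_eq_vec_def by blast+
  moreover have "p $ i = p' $ i + 1" "q $ i = q' $ i + 1"
    unfolding p q by (simp_all add: axis_def)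
  ultimately show False
    by linarith
qed

section \<open>Faces\<close>

text \<open>
  As all points lie on the hyperplane \<open>w \<bullet> x = 1\<close>, the supporting hyperplane \<open>z \<bullet> x = c\<close> of a face can
  be replaced by the linear one with normal vector \<open>z - c w\<close>. This makes the face functional
  vanish on the whole span of the face.
\<close>

lemma combinatorial_pure_linear_functional:
  assumes "configuration a" and "combinatorial_pure (points a) B"
  obtains \<phi> where "\<And>i. \<phi> \<bullet> real_vec (a i) \<le> 0"
    and "\<And>i. \<phi> \<bullet> real_vec (a i) = 0 \<longleftrightarrow> i \<in> vars_of a B"
proof -
  obtain w where w: "\<And>i. w \<bullet> real_vec (a i) = 1"
    using assms(1) by (auto simp: configuration_def)
  obtain F where "F exposed_face_of (convex hull (points a))" and B: "B = points a \<inter> F"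
    using assms(2) by (auto simp: combinatorial_pure_def)
  then obtain z c where z: "convex hull (points a) \<subseteq> {x. z \<bullet> x \<le> c}"
      and F: "F = convex hull (points a) \<inter> {x. z \<bullet> x = c}"
    by (auto simp: exposed_face_of_def)
  have hull: "real_vec (a i) \<in> convex hull (points a)" and point: "real_vec (a i) \<in> points a" for i
    by (auto simp: points_def intro: hull_inc)
  have le: "z \<bullet> real_vec (a i) \<le> c" for i
    using z hull by blast
  show ?thesis
  proof
    show "(z - c *\<^sub>R w) \<bullet> real_vec (a i) \<le> 0" for i
      using le by (simp add: inner_diff_left w)
    show "(z - c *\<^sub>R w) \<bullet> real_vec (a i) = 0 \<longleftrightarrow> i \<in> vars_of a B" for i
      using hull point by (simp add: inner_diff_left w vars_of_def B F)
  qed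
qed

lemma representation_stays_in_face:
  fixes a :: "'n::finite \<Rightarrow> nat ^ 'd::finite"
  assumes le: "\<And>i. \<phi> \<bullet> real_vec (a i) \<le> 0"
    and eq: "\<And>i. \<phi> \<bullet> real_vec (a i) = 0 \<longleftrightarrow> i \<in> J"
    and supp: "\<And>i. r $ i \<noteq> 0 \<Longrightarrow> i \<in> J"
    and rel: "represented_point a r = represented_point a s"
    and "s $ i \<noteq> 0"
  shows "i \<in> J"
proof -
  have val: "\<phi> \<bullet> real_vec (represented_point a m) = (\<Sum>i\<in>UNIV. real (m $ i) * (\<phi> \<bullet> real_vec (a i)))" for m
    by (simp add: real_vec_represented_point inner_sum_right)
  have "\<phi> \<bullet> real_vec (represented_point a r) = 0"
    unfolding val using supp eq by (intro sum.neutral) (metis mult_eq_0_iff of_nat_0)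
  then have "(\<Sum>i\<in>UNIV. real (s $ i) * (\<phi> \<bullet> real_vec (a i))) = 0"
    by (simp add: rel val)
  then have "\<forall>i\<in>UNIV. - (real (s $ i) * (\<phi> \<bullet> real_vec (a i))) = 0"
    using le by (subst sum_nonneg_eq_0_iff[symmetric])
      (auto simp: sum_negf mult_nonneg_nonpos)
  then have "- (real (s $ i) * (\<phi> \<bullet> real_vec (a i))) = 0"
    by (rule bspec) simp
  then show ?thesis
    using \<open>s $ i \<noteq> 0\<close> eq[of i] by auto
qed

section \<open>Holes\<close>

text \<open>
  The holes are \<open>\<beta> + m a\<^sub>k\<close> with \<open>\<beta> = \<Sum> \<lceil>p\<^sub>i/2\<rceil> a\<^sub>i - \<Sum> \<lfloor>q\<^sub>i/2\<rfloor> a\<^sub>i\<close>. They are in the cone because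
  subtracting half of the relation between \<open>p\<close> and \<open>q\<close> leaves non-negative coefficients. The index \<open>i\<close>
  prevents \<open>\<lceil>p/2\<rceil> + m e\<^sub>k\<close> from dominating \<open>p\<close>, and the index \<open>j\<close>, at which this exponent vanishes,
  prevents it from dominating \<open>q\<close>. So it is the only exponent that represents its point, and
  \<open>\<lfloor>q/2\<rfloor>\<close>, which is positive at \<open>j\<close>, cannot be subtracted from it.
\<close>

lemma half_relation_gives_infinitely_many_holes:
  fixes a :: "'n::finite \<Rightarrow> nat ^ 'd::finite"
  assumes conf: "configuration a"
    and le: "\<And>i. \<phi> \<bullet> real_vec (a i) \<le> 0"
    and eq: "\<And>i. \<phi> \<bullet> real_vec (a i) = 0 \<longleftrightarrow> i \<in> J"
    and dominates: "\<And>r s. (\<And>i. r $ i \<noteq> 0 \<Longrightarrow> i \<in> J) \<Longrightarrow> (\<And>i. s $ i \<noteq> 0 \<Longrightarrow> i \<in> J) \<Longrightarrow>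
      represented_point a r = represented_point a s \<Longrightarrow> r \<noteq> s \<Longrightarrow> p \<le> r \<or> q \<le> r"
    and supp: "\<And>i. p $ i \<noteq> 0 \<Longrightarrow> i \<in> J"
    and rel: "represented_point a p = represented_point a q"
    and disjoint: "\<And>i. p $ i = 0 \<or> q $ i = 0"
    and i: "p $ i \<ge> 2" and j: "q $ j \<ge> 2" and k: "p $ k \<noteq> 0" "k \<noteq> i"
  shows "\<not> very_ample (points a)"
proof -
  define up where "up m = (\<chi> l. (p $ l + 1) div 2 + (if l = k then m else 0))" for m
  define down where "down = (\<chi> l. q $ l div 2)"
  define hole where "hole m = real_vec (represented_point a (up m)) - real_vec (represented_point a down)" for m
  have hole_sum: "hole m = (\<Sum>l\<in>UNIV. (real (up m $ l) - real (down $ l)) *\<^sub>R real_vec (a l))" for m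
    by (simp add: hole_def real_vec_represented_point sum_subtractf scaleR_left_diff_distrib)
  have lattice: "hole m \<in> combinations \<int> (points a)" for m
    unfolding combinations_points[OF conf] hole_sum by (auto intro!: exI)
  have cone: "hole m \<in> combinations {q \<in> \<rat>. 0 \<le> q} (points a)" for m
  proof -
    define c where "c l = real (up m $ l) - real (down $ l) - (real (p $ l) - real (q $ l)) / 2" for l
    have "(\<Sum>l\<in>UNIV. (real (p $ l) - real (q $ l)) *\<^sub>R real_vec (a l)) = 0"
      using rel by (simp add: scaleR_left_diff_distrib sum_subtractf flip: real_vec_represented_point)
    then have "(\<Sum>l\<in>UNIV. ((real (p $ l) - real (q $ l)) / 2) *\<^sub>R real_vec (a l)) = 0"
      using scaleR_right.sum[of "1 / 2" "\<lambda>l. (real (p $ l) - real (q $ l)) *\<^sub>R real_vec (a l)" UNIV]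
      by simp
    then have "hole m = (\<Sum>l\<in>UNIV. c l *\<^sub>R real_vec (a l))"
      by (simp add: hole_sum c_def scaleR_left_diff_distrib sum_subtractf)
    moreover have "c l \<in> \<rat>" for l
      by (simp add: c_def)
    moreover have "c l \<ge> 0" for l
    proof -
      have "p $ l + 2 * down $ l \<le> 2 * up m $ l + q $ l"
        by (simp add: up_def down_def)
      then have "real (p $ l + 2 * down $ l) \<le> real (2 * up m $ l + q $ l)"
        by (simp only: of_nat_le_iff)
      then show ?thesis
        by (simp add: c_def field_simps)
    qed
    ultimately show ?thesis
      unfolding combinations_points[OF conf] by blast
  qed
  have not_semigroup: "hole m \<notin> combinations \<nat> (points a)" for m
  proof
    assume "hole m \<in> combinations \<nat> (points a)"
    then obtain c where c: "hole m = (\<Sum>l\<in>UNIV. c l *\<^sub>R real_vec (a l))" "\<And>l. c l \<in> \<nat>"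
      unfolding combinations_points[OF conf] by blast
    from c(2) have "\<forall>l. \<exists>k. c l = real k"
      unfolding Nats_def by blast
    then obtain n where n: "\<And>l. c l = real (n l)"
      unfolding choice_iff by blast
    define s where "s = (\<chi> l. n l)"
    have "hole m = real_vec (represented_point a s)"
      using c n by (simp add: real_vec_represented_point s_def)
    then have "real_vec (represented_point a (up m)) = real_vec (represented_point a (s + down))"
      by (simp add: hole_def represented_point_add real_vec_add algebra_simps)
    then have same: "represented_point a (up m) = represented_point a (s + down)"
      by (simp add: real_vec_inject)
    have supp_up: "\<And>l. up m $ l \<noteq> 0 \<Longrightarrow> l \<in> J"
      using supp k by (force simp: up_def split: if_splits)
    have supp_down: "\<And>l. (s + down) $ l \<noteq> 0 \<Longrightarrow> l \<in> J"
      using representation_stays_in_face[OF le eq supp_up same] by blast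
    have "q $ i = 0" "p $ j = 0" "j \<noteq> k"
      using disjoint[of i] disjoint[of j] i j k by auto
    have "up m $ i < p $ i"
      using i k by (simp add: up_def)
    moreover have up_j: "up m $ j = 0"
      using \<open>p $ j = 0\<close> \<open>j \<noteq> k\<close> by (simp add: up_def)
    ultimately have "\<not> p \<le> up m" "\<not> q \<le> up m"
      using j unfolding less_eq_vec_def by (metis not_le, metis le_zero_eq not_numeral_le_zero)
    then have "up m = s + down"
      using dominates[of "up m" "s + down"] supp_up supp_down same by blast
    then have "down $ j = 0"
      using up_j by (simp add: vec_eq_iff)
    then show False
      using j by (simp add: down_def)
  qed
  have "inj hole"
  proof (rule injI)
    fix m m' assume "hole m = hole m'"
    obtain w where w: "\<And>i. w \<bullet> real_vec (a i) = 1"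
      using conf by (auto simp: configuration_def)
    have up: "real (up m $ l) = real ((p $ l + 1) div 2) + (if l = k then real m else 0)" for m l
      by (simp add: up_def)
    have "w \<bullet> hole m = (\<Sum>l\<in>UNIV. real ((p $ l + 1) div 2) - real (down $ l)) + real m" for m
      by (simp add: hole_sum inner_sum_right w up sum.distrib sum_subtractf)
    from this[of m] this[of m'] have "real m = real m'"
      unfolding \<open>hole m = hole m'\<close> by linarith
    then show "m = m'"
      by (rule of_nat_eq_iff[THEN iffD1])
  qed
  then have "infinite (range hole)"
    by (rule range_inj_infinite)
  moreover have "range hole \<subseteq>
      (combinations \<int> (points a) \<inter> combinations {q \<in> \<rat>. 0 \<le> q} (points a)) - combinations \<nat> (points a)"
    using lattice cone not_semigroup by auto
  ultimately show ?thesis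
    unfolding very_ample_def by (metis finite_subset)
qed

text \<open>
  A relation \<open>b a\<^sub>i = c a\<^sub>j\<close> with \<open>b > 0\<close> has \<open>b = c\<close> by homogeneity, hence \<open>a\<^sub>i = a\<^sub>j\<close>.
\<close>

lemma relation_between_two_points_trivial:
  fixes a :: "'n::finite \<Rightarrow> nat ^ 'd::finite"
  assumes conf: "configuration a"
    and rel: "represented_point a p = represented_point a q"
    and p: "\<And>l. l \<noteq> i \<Longrightarrow> p $ l = 0" and q: "\<And>l. l \<noteq> j \<Longrightarrow> q $ l = 0" and pos: "p $ i \<noteq> 0"
  shows "i = j"
proof -
  obtain w where w: "\<And>i. w \<bullet> real_vec (a i) = 1" and inj: "inj a"
    using conf by (auto simp: configuration_def)
  have single: "real_vec (represented_point a m) = real (m $ l) *\<^sub>R real_vec (a l)"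
    if "\<And>l'. l' \<noteq> l \<Longrightarrow> m $ l' = 0" for m l
    unfolding real_vec_represented_point using that
    by (subst sum.remove[of _ l]) (auto intro: sum.neutral)
  have eq: "real (p $ i) *\<^sub>R real_vec (a i) = real (q $ j) *\<^sub>R real_vec (a j)"
    using single[of i p] single[of j q] p q rel by metis
  then have "w \<bullet> (real (p $ i) *\<^sub>R real_vec (a i)) = w \<bullet> (real (q $ j) *\<^sub>R real_vec (a j))"
    by (rule arg_cong)
  then have "p $ i = q $ j"
    by (simp add: w)
  then have "a i = a j"
    using eq pos by (simp add: real_vec_inject)
  then show ?thesis
    using inj by (simp add: inj_eq)
qed

theorem theorem4:
  fixes a :: "'n::finite \<Rightarrow> nat ^ 'd::finite"
    and g u v :: "('n, 'k::field) mpoly"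
  assumes "configuration a"
    and "fundamental_binomial a g"
    and "is_monomial u" and "is_monomial v" and "g = u - v"
    and "\<not> squarefree_monomial u" and "\<not> squarefree_monomial v"
  shows "\<not> very_ample (points a)"
proof -
  obtain p q where u: "u = mpoly_monom p" and v: "v = mpoly_monom q"
    using assms(3,4) by (auto simp: is_monomial_def)
  obtain i where i: "p $ i \<ge> 2"
    using assms(6) unfolding u by (rule not_squarefree_mpoly_monom)
  obtain j where j: "q $ j \<ge> 2"
    using assms(7) unfolding v by (rule not_squarefree_mpoly_monom)
  obtain B where pure: "combinatorial_pure (points a) B"
      and principal: "toric_ideal a B = principal_ideal_in (vars_of a B) (mpoly_monom p - mpoly_monom q :: ('n, 'k) mpoly)"
    using assms(2,5) u v by (auto simp: fundamental_binomial_def)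
  have "p \<noteq> q"
    using assms(2,5) u v by (auto simp: fundamental_binomial_def is_binomial_def)
  have "(1 :: ('n, 'k) mpoly) \<in> polys_in (vars_of a B)"
    by (simp add: polys_in_def)
  then have "(mpoly_monom p - mpoly_monom q :: ('n, 'k) mpoly) \<in> toric_ideal a B"
    unfolding principal principal_ideal_in_def by (metis (mono_tags, lifting) mem_Collect_eq mult_1)
  then have supp: "\<And>i. p $ i \<noteq> 0 \<Longrightarrow> i \<in> vars_of a B" "\<And>i. q $ i \<noteq> 0 \<Longrightarrow> i \<in> vars_of a B"
    and rel: "represented_point a p = represented_point a q"
    using mpoly_monom_diff_in_toric_ideal_iff[OF \<open>p \<noteq> q\<close>] by blast+
  note dominates = principal_relation_dominates[OF principal]
  have dominates': "q \<le> r \<or> p \<le> r" if "\<And>i. r $ i \<noteq> 0 \<Longrightarrow> i \<in> vars_of a B"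
    "\<And>i. s $ i \<noteq> 0 \<Longrightarrow> i \<in> vars_of a B" "represented_point a r = represented_point a s" "r \<noteq> s" for r s
    using dominates[OF that] by blast
  have disjoint: "p $ l = 0 \<or> q $ l = 0" for l
    by (rule minimal_relation_disjoint_support[OF dominates supp rel \<open>p \<noteq> q\<close>])
  obtain \<phi> where le: "\<And>i. \<phi> \<bullet> real_vec (a i) \<le> 0"
    and eq: "\<And>i. \<phi> \<bullet> real_vec (a i) = 0 \<longleftrightarrow> i \<in> vars_of a B"
    using combinatorial_pure_linear_functional[OF assms(1) pure] by blast
  have "i \<noteq> j"
    using disjoint[of i] i j by auto
  then consider k where "p $ k \<noteq> 0" "k \<noteq> i" | k where "q $ k \<noteq> 0" "k \<noteq> j"
    using relation_between_two_points_trivial[OF assms(1) rel, of i j] i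
    by (metis not_numeral_le_zero)
  then show ?thesis
  proof cases
    case 1
    show ?thesis
      by (rule half_relation_gives_infinitely_many_holes
          [OF assms(1) le eq dominates supp(1) rel disjoint i j 1])
  next
    case 2
    have disjoint': "q $ l = 0 \<or> p $ l = 0" for l
      using disjoint[of l] by auto
    show ?thesis
      by (rule half_relation_gives_infinitely_many_holes
          [OF assms(1) le eq dominates' supp(2) rel[symmetric] disjoint' j i 2])
  qed
qed

end
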